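(* Let $r\ge 2$ and $k\ge 0$ be integers and let $Y$ be a finite 2-dimensional simplicial complex of degree at most $r$. Then $Y$ is not collapsible to a graph in at most $k$ steps if and only if there is $S\in\mathcal{L}_{k,r}$ which admits a simplicial embedding $S\to Y$.
   Context: All complexes are finite simplicial complexes of dimension at most 2. A complex has degree $\le r$ if every edge is contained in at most $r$ 2-simplexes. An edge is free if it is contained in exactly one 2-simplex; the boundary $\partial Y$ is the union of the free edges; a 2-simplex is free if at least one of its edges is free. Collapsing: let $\sigma_1,\dots,\sigma_m$ be all the free 2-simplexes of $Y$ and choose a free edge $e_i\subset\sigma_i$ for each $i$. Put $Y'=Y-\bigcup_i \mathrm{int}(\sigma_i)-\bigcup_i\mathrm{int}(e_i)$ (the set of 2-simplexes of $Y'$ does not depend on the choice of the $e_i$). Iterate: $Y^{(0)}=Y$, $Y^{(i+1)}=(Y^{(i)})'$. $Y$ is collapsible to a graph in at most $k$ steps if $Y^{(k)}$ is a graph, i.e. has no 2-simplexes. For a 2-simplex $\sigma$ of $Y$, $D_Y(\sigma)=\sup\{i:\sigma\subset Y^{(i)}\}\in\{0,1,\dots,\infty\}$. Two 2-simplexes are adjacent if they intersect in an edge. The distance $d_Y(\sigma,\tau)$ is the minimal $m$ for which there are 2-simplexes $\sigma=\sigma_0,\dots,\sigma_m=\tau$ of $Y$ with $\sigma_i$ adjacent to $\sigma_{i+1}$ for all $0\le i<m$ (it is $\infty$ if no such sequence exists). A complex is strongly connected if the maximum of $d_Y(\sigma,\tau)$ over pairs of 2-simplexes is finite; it is pure if every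 maximal simplex is 2-dimensional. An $r$-pseudo-surface is a finite, pure, strongly connected 2-dimensional simplicial complex of degree at most $r$. $\mathcal{L}_{k,r}$ is the set of all isomorphism types of $r$-pseudo-surfaces $S$ with a specified 2-simplex $\sigma_\ast$ (the center) such that: if $\partial S\ne\emptyset$ then $D_S(\sigma_\ast)=k$; and $d_S(\sigma_\ast,\sigma)\le k$ for every 2-simplex $\sigma$ of $S$. A simplicial embedding is an injective simplicial map. *)

theory Defs
  imports Main "HOL-Library.Extended_Nat"
begin

text \<open>
  Complexes are abstract: a complex is the set of its (nonempty) simplexes, and a simplex
  is the set of its vertices.
\<close>

definition finite_complex :: "'a set set \<Rightarrow> bool" where
  "finite_complex Y \<longleftrightarrow>
     finite Y \<and> (\<forall>\<sigma>\<in>Y. finite \<sigma> \<and> \<sigma> \<noteq> {} \<and> (\<forall>\<tau>. \<tau> \<noteq> {} \<and> \<tau> \<subseteq> \<sigma> \<longrightarrow> \<tau> \<in> Y))"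

definition simplexes :: "nat \<Rightarrow> 'a set set \<Rightarrow> 'a set set" where
  "simplexes n Y = {\<sigma> \<in> Y. card \<sigma> = n + 1}"

definition finite_2_complex :: "'a set set \<Rightarrow> bool" where
  "finite_2_complex Y \<longleftrightarrow> finite_complex Y \<and> (\<forall>\<sigma>\<in>Y. card \<sigma> \<le> 3)"

definition degree_le :: "nat \<Rightarrow> 'a set set \<Rightarrow> bool" where
  "degree_le r Y \<longleftrightarrow> (\<forall>e \<in> simplexes 1 Y. card {\<sigma> \<in> simplexes 2 Y. e \<subseteq> \<sigma>} \<le> r)"


definition free_edges :: "'a set set \<Rightarrow> 'a set set" where
  "free_edges Y = {e \<in> simplexes 1 Y. \<exists>!\<sigma>. \<sigma> \<in> simplexes 2 Y \<and> e \<subseteq> \<sigma>}"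

text \<open>The union of the free edges, as a subcomplex.\<close>

definition boundary :: "'a set set \<Rightarrow> 'a set set" where
  "boundary Y = {\<tau>. \<tau> \<noteq> {} \<and> (\<exists>e \<in> free_edges Y. \<tau> \<subseteq> e)}"

definition free_triangles :: "'a set set \<Rightarrow> 'a set set" where
  "free_triangles Y = {\<sigma> \<in> simplexes 2 Y. \<exists>e \<in> free_edges Y. e \<subseteq> \<sigma>}"

definition collapse_along :: "('a set \<Rightarrow> 'a set) \<Rightarrow> 'a set set \<Rightarrow> 'a set set" where
  "collapse_along e Y = Y - free_triangles Y - e ` free_triangles Y"

definition admissible_choice :: "'a set set \<Rightarrow> ('a set \<Rightarrow> 'a set) \<Rightarrow> bool" where
  "admissible_choice Y e \<longleftrightarrow> (\<forall>\<sigma> \<in> free_triangles Y. e \<sigma> \<in> free_edges Y \<and> e \<sigma> \<subseteq> \<sigma>)"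

definition collapse :: "'a set set \<Rightarrow> 'a set set" where
  "collapse Y = collapse_along (SOME e. admissible_choice Y e) Y"

text \<open>
  An admissible choice exists, and the 2-simplexes that remain are the same for all of them.
\<close>

lemma admissible_choice_exists: "\<exists>e. admissible_choice Y e"
  unfolding admissible_choice_def free_triangles_def by (intro bchoice) blast

lemma simplexes_2_collapse_along:
  assumes "admissible_choice Y e"
  shows "simplexes 2 (collapse_along e Y) = simplexes 2 Y - free_triangles Y"
  using assms
  unfolding admissible_choice_def collapse_along_def simplexes_def free_edges_def by auto

text \<open>
  Which 2-simplexes are free depends only on the set of 2-simplexes, so later collapsing
  steps are independent of earlier choices as well.
\<close>

lemma free_triangles_cong:
  assumes "finite_complex Y" "finite_complex Z" "simplexes 2 Y = simplexes 2 Z"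
  shows "free_triangles Y = free_triangles Z"
proof -
  have "e \<in> Y \<longleftrightarrow> e \<in> Z" if "card e = 2" "e \<subseteq> \<sigma>" "\<sigma> \<in> simplexes 2 Y" for e \<sigma> :: "'a set"
  proof -
    have "e \<noteq> {}" using that(1) by auto
    moreover have "\<sigma> \<in> Y" "\<sigma> \<in> Z" using that(3) assms(3) by (auto simp: simplexes_def)
    ultimately show ?thesis using assms(1,2) that(2) unfolding finite_complex_def by blast
  qed
  then have "free_edges Y = free_edges Z"
    unfolding free_edges_def assms(3)[symmetric] by (auto simp: simplexes_def)
  then show ?thesis unfolding free_triangles_def assms(3) by simp
qed

lemma finite_2_complex_collapse:
  assumes "finite_2_complex Y"
  shows "finite_2_complex (collapse Y)"
proof -
  define e where "e = (SOME e. admissible_choice Y e)"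
  have adm: "admissible_choice Y e"
    unfolding e_def by (rule someI_ex[OF admissible_choice_exists])
  have Y: "finite_complex Y" and dim: "\<And>\<sigma>. \<sigma> \<in> Y \<Longrightarrow> card \<sigma> \<le> 3"
    using assms unfolding finite_2_complex_def by auto
  have "\<tau> \<in> collapse_along e Y"
    if \<rho>: "\<rho> \<in> collapse_along e Y" and \<tau>: "\<tau> \<noteq> {}" "\<tau> \<subseteq> \<rho>" for \<rho> \<tau>
  proof -
    have \<rho>Y: "\<rho> \<in> Y" "\<rho> \<notin> free_triangles Y"
      using \<rho> unfolding collapse_along_def by auto
    then have fin: "finite \<rho>" and \<tau>Y: "\<tau> \<in> Y"
      using Y \<tau> unfolding finite_complex_def by blast+
    have "\<tau> \<notin> free_triangles Y"
    proof
      assume t: "\<tau> \<in> free_triangles Y"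
      then have "card \<tau> = 3" by (auto simp: free_triangles_def simplexes_def)
      then have "\<tau> = \<rho>" using dim[OF \<rho>Y(1)] fin \<tau>(2)
        by (intro card_seteq) auto
      then show False using t \<rho>Y by simp
    qed
    moreover have "\<tau> \<notin> e ` free_triangles Y"
    proof
      assume t: "\<tau> \<in> e ` free_triangles Y"
      then have fe: "\<tau> \<in> free_edges Y" using adm unfolding admissible_choice_def by auto
      then have c: "card \<tau> = 2" by (auto simp: free_edges_def simplexes_def)
      show False
      proof (cases "\<tau> = \<rho>")
        case True then show False using t \<rho> unfolding collapse_along_def by simp
      next
        case False
        then have "card \<tau> < card \<rho>" using \<tau>(2) fin by (simp add: psubset_card_mono psubsetI)
        then have "card \<rho> = 3" using dim[OF \<rho>Y(1)] c by simp
        then have "\<rho> \<in> free_triangles Y"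
          using fe \<tau>(2) \<rho>Y(1) by (auto simp: free_triangles_def simplexes_def)
        then show False using \<rho>Y by simp
      qed
    qed
    ultimately show ?thesis using \<tau>Y unfolding collapse_along_def by simp
  qed
  moreover have sub: "collapse_along e Y \<subseteq> Y" unfolding collapse_along_def by auto
  moreover have "finite (collapse_along e Y)"
    using Y sub unfolding finite_complex_def by (meson finite_subset)
  moreover have "finite \<sigma> \<and> \<sigma> \<noteq> {}" if "\<sigma> \<in> collapse_along e Y" for \<sigma>
    using Y subsetD[OF sub that] unfolding finite_complex_def by simp
  ultimately show ?thesis
    using dim unfolding collapse_def e_def[symmetric] finite_2_complex_def finite_complex_def
    by (metis subsetD)
qed

definition collapsible_to_graph_in :: "nat \<Rightarrow> 'a set set \<Rightarrow> bool" where
  "collapsible_to_graph_in k Y \<longleftrightarrow> simplexes 2 ((collapse ^^ k) Y) = {}"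

definition collapse_depth :: "'a set set \<Rightarrow> 'a set \<Rightarrow> enat" where
  "collapse_depth Y \<sigma> = Sup {enat i | i. \<sigma> \<in> (collapse ^^ i) Y}"


definition adjacent :: "'a set \<Rightarrow> 'a set \<Rightarrow> bool" where
  "adjacent \<sigma> \<tau> \<longleftrightarrow> card (\<sigma> \<inter> \<tau>) = 2"

definition triangle_path :: "'a set set \<Rightarrow> 'a set \<Rightarrow> 'a set \<Rightarrow> nat \<Rightarrow> bool" where
  "triangle_path Y \<sigma> \<tau> m \<longleftrightarrow>
     (\<exists>s :: nat \<Rightarrow> 'a set. s 0 = \<sigma> \<and> s m = \<tau> \<and> (\<forall>i\<le>m. s i \<in> simplexes 2 Y) \<and>
        (\<forall>i<m. adjacent (s i) (s (Suc i))))"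

text \<open>The infimum of the empty set is \<open>\<infinity>\<close>.\<close>

definition triangle_dist :: "'a set set \<Rightarrow> 'a set \<Rightarrow> 'a set \<Rightarrow> enat" where
  "triangle_dist Y \<sigma> \<tau> = Inf {enat m | m. triangle_path Y \<sigma> \<tau> m}"

definition strongly_connected :: "'a set set \<Rightarrow> bool" where
  "strongly_connected Y \<longleftrightarrow>
     (SUP \<sigma> \<in> simplexes 2 Y. SUP \<tau> \<in> simplexes 2 Y. triangle_dist Y \<sigma> \<tau>) < \<infinity>"

definition pure :: "'a set set \<Rightarrow> bool" where
  "pure Y \<longleftrightarrow> (\<forall>\<sigma>\<in>Y. (\<forall>\<tau>\<in>Y. \<sigma> \<subseteq> \<tau> \<longrightarrow> \<tau> = \<sigma>) \<longrightarrow> \<sigma> \<in> simplexes 2 Y)"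

definition pseudo_surface :: "nat \<Rightarrow> 'a set set \<Rightarrow> bool" where
  "pseudo_surface r S \<longleftrightarrow>
     finite_2_complex S \<and> simplexes 2 S \<noteq> {} \<and> pure S \<and> strongly_connected S \<and> degree_le r S"

definition centered_surface :: "nat \<Rightarrow> nat \<Rightarrow> 'a set set \<times> 'a set \<Rightarrow> bool" where
  "centered_surface k r = (\<lambda>(S, c).
     pseudo_surface r S \<and> c \<in> simplexes 2 S \<and>
     (boundary S \<noteq> {} \<longrightarrow> collapse_depth S c = enat k) \<and>
     (\<forall>\<sigma> \<in> simplexes 2 S. triangle_dist S c \<sigma> \<le> enat k))"


definition simplicial_embedding :: "('a \<Rightarrow> 'b) \<Rightarrow> 'a set set \<Rightarrow> 'b set set \<Rightarrow> bool" where
  "simplicial_embedding f S Y \<longleftrightarrow> inj_on f (\<Union>S) \<and> (\<forall>\<sigma>\<in>S. f ` \<sigma> \<in> Y)"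

definition centered_iso :: "'a set set \<times> 'a set \<Rightarrow> 'b set set \<times> 'b set \<Rightarrow> bool" where
  "centered_iso = (\<lambda>(S, c) (T, d).
     \<exists>f. bij_betw f (\<Union>S) (\<Union>T) \<and> (\<lambda>\<sigma>. f ` \<sigma>) ` S = T \<and> f ` c = d)"

text \<open>
  Isomorphism types, as isomorphism classes of complexes with vertices in \<open>nat\<close>: every finite
  complex is isomorphic to one of these.
\<close>

definition \<L> :: "nat \<Rightarrow> nat \<Rightarrow> (nat set set \<times> nat set) set set" where
  "\<L> k r = Collect (centered_surface k r) //
     {(x, y). centered_surface k r x \<and> centered_surface k r y \<and> centered_iso x y}"

lemma equiv_centered_iso:
  "equiv (Collect P) {(x, y). P x \<and> P y \<and> centered_iso x y}"
  if "\<And>S c. P (S, c) \<Longrightarrow> c \<in> S"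
proof (rule equivI)
  show "{(x, y). P x \<and> P y \<and> centered_iso x y} \<subseteq> Collect P \<times> Collect P" by auto
  have "centered_iso x x" for x :: "'a set set \<times> 'a set"
    unfolding centered_iso_def by (auto intro!: exI[of _ id])
  then show "refl_on (Collect P) {(x, y). P x \<and> P y \<and> centered_iso x y}"
    by (auto simp: refl_on_def)
  have "centered_iso (T, d) (S, c)" if iso: "centered_iso (S, c) (T, d)" and "c \<in> S"
    for S T :: "'a set set" and c d
  proof -
    obtain f where f: "bij_betw f (\<Union>S) (\<Union>T)" "(\<lambda>\<sigma>. f ` \<sigma>) ` S = T" "f ` c = d"
      using iso unfolding centered_iso_def by auto
    define g where "g = inv_into (\<Union>S) f"
    have g: "g ` f ` \<sigma> = \<sigma>" if "\<sigma> \<in> S" for \<sigma>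
      using that f(1) unfolding g_def bij_betw_def by (intro inv_into_image_cancel) auto
    have "(\<lambda>\<sigma>. g ` \<sigma>) ` T = S"
      using g unfolding f(2)[symmetric] image_image[of "image g"] by simp
    moreover have "bij_betw g (\<Union>T) (\<Union>S)"
      unfolding g_def using f(1) by (rule bij_betw_inv_into)
    ultimately show ?thesis using g[OF \<open>c \<in> S\<close>] f(3) unfolding centered_iso_def by auto
  qed
  then show "sym {(x, y). P x \<and> P y \<and> centered_iso x y}"
    using that by (auto simp: sym_def)
  have "centered_iso x z" if xy: "centered_iso x y" and yz: "centered_iso y z"
    for x y z :: "'a set set \<times> 'a set"
  proof -
    obtain f where f: "bij_betw f (\<Union>(fst x)) (\<Union>(fst y))" "(\<lambda>\<sigma>. f ` \<sigma>) ` fst x = fst y"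
        "f ` snd x = snd y"
      using xy unfolding centered_iso_def by (auto split: prod.splits)
    obtain g where g: "bij_betw g (\<Union>(fst y)) (\<Union>(fst z))" "(\<lambda>\<sigma>. g ` \<sigma>) ` fst y = fst z"
        "g ` snd y = snd z"
      using yz unfolding centered_iso_def by (auto split: prod.splits)
    have "bij_betw (g \<circ> f) (\<Union>(fst x)) (\<Union>(fst z))" using f(1) g(1) by (rule bij_betw_trans)
    moreover have "(\<lambda>\<sigma>. (g \<circ> f) ` \<sigma>) ` fst x = fst z"
      unfolding g(2)[symmetric] f(2)[symmetric] by (simp add: image_image image_comp)
    moreover have "(g \<circ> f) ` snd x = snd z" using f(3) g(3) by (metis image_comp)
    ultimately show ?thesis
      unfolding centered_iso_def case_prod_beta by (intro exI[of _ "g \<circ> f"] conjI)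
  qed
  then show "trans {(x, y). P x \<and> P y \<and> centered_iso x y}"
    unfolding trans_def mem_Collect_eq case_prod_conv by metis
qed

text \<open>An isomorphism type embeds if one of its representatives does.\<close>

definition embeds :: "('b set set \<times> 'b set) set \<Rightarrow> 'a set set \<Rightarrow> bool" where
  "embeds \<S> Y \<longleftrightarrow> (\<exists>(S, c) \<in> \<S>. \<exists>f. simplicial_embedding f S Y)"

end

theory Submission
  imports Defs
begin

text \<open>
  Collapsing is determined by the set of 2-simplexes, on which it acts by peeling off the
  triangles with an unshared edge. Peeling is monotone along embeddings, which gives one
  direction. For the other, take a set of triangles of \<open>Y\<close>, minimal among those that survive
  \<open>k\<close> peelings, and a survivor \<open>c\<close>. Survival of \<open>c\<close> depends only on the ball of radius \<open>k\<close>
  around \<open>c\<close>, so the set is that ball. If it has a free edge, one peeling makes it strictly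
  smaller, so by minimality nothing survives \<open>k + 1\<close> peelings and \<open>c\<close> has depth exactly \<open>k\<close>.
\<close>

section \<open>Peeling sets of triangles\<close>

text \<open>Acting on the bare set of triangles, peeling involves no choice of free edges and does
  not have to track which edges remain. An edge is any two-element subset of a triangle.\<close>

definition peel :: "'a set set \<Rightarrow> 'a set set" where
  "peel T = {\<sigma> \<in> T. \<forall>e. e \<subseteq> \<sigma> \<and> card e = 2 \<longrightarrow> (\<exists>\<tau> \<in> T. \<tau> \<noteq> \<sigma> \<and> e \<subseteq> \<tau>)}"

lemma mem_peel_iff:
  "\<sigma> \<in> peel T \<longleftrightarrow> \<sigma> \<in> T \<and> (\<forall>e. e \<subseteq> \<sigma> \<and> card e = 2 \<longrightarrow> (\<exists>\<tau> \<in> T. \<tau> \<noteq> \<sigma> \<and> e \<subseteq> \<tau>))"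
  by (simp add: peel_def)

lemma peel_subset: "peel T \<subseteq> T"
  by (auto simp: mem_peel_iff)

lemma funpow_peel_antimono: "i \<le> j \<Longrightarrow> (peel ^^ j) T \<subseteq> (peel ^^ i) T"
  by (rule lift_Suc_antimono_le) (auto simp: mem_peel_iff)

lemma funpow_peel_subset: "(peel ^^ i) T \<subseteq> T"
  using funpow_peel_antimono[of 0 i T] by simp

text \<open>A triangle that keeps an edge of \<open>\<sigma>\<close> from being free in
  \<open>S\<close> maps to one that does the same for the image edge in \<open>T\<close>; further
  triangles of \<open>T\<close> can only help survival.\<close>

lemma funpow_peel_image:
  assumes inj: "inj_on f (\<Union>S)" and sub: "\<And>\<sigma>. \<sigma> \<in> S \<Longrightarrow> f ` \<sigma> \<in> T"
  shows "\<sigma> \<in> (peel ^^ i) S \<Longrightarrow> f ` \<sigma> \<in> (peel ^^ i) T"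
proof (induction i arbitrary: \<sigma>)
  case 0
  then show ?case using sub by simp
next
  case (Suc i)
  have \<sigma>: "\<sigma> \<in> (peel ^^ i) S" "\<sigma> \<in> S"
    using Suc.prems funpow_peel_antimono[of i "Suc i" S] funpow_peel_subset[of "Suc i" S] by auto
  have "\<exists>\<rho> \<in> (peel ^^ i) T. \<rho> \<noteq> f ` \<sigma> \<and> e' \<subseteq> \<rho>" if e': "e' \<subseteq> f ` \<sigma>" "card e' = 2" for e'
  proof -
    obtain e where e: "e \<subseteq> \<sigma>" "e' = f ` e" using e'(1) by (auto simp: subset_image_iff)
    have "inj_on f e" using inj by (rule inj_on_subset) (use e \<sigma> in auto)
    then have "card e = 2" using e e'(2) card_image by fastforce
    then obtain \<tau> where \<tau>: "\<tau> \<in> (peel ^^ i) S" "\<tau> \<noteq> \<sigma>" "e \<subseteq> \<tau>"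
      using Suc.prems e(1) unfolding funpow.simps o_apply mem_peel_iff by blast
    moreover have "\<tau> \<in> S" using \<tau>(1) funpow_peel_subset by blast
    \<comment> \<open>Injectivity on all vertices is needed here: it keeps the second triangle at
      the edge distinct from the first.\<close>
    ultimately have "f ` \<tau> \<noteq> f ` \<sigma>"
      using inj_on_image_eq_iff[OF inj, of \<tau> \<sigma>] \<sigma>(2) by auto
    then show ?thesis using Suc.IH[OF \<tau>(1)] e \<tau>(3) by (intro bexI[of _ "f ` \<tau>"]) auto
  qed
  then show ?case using Suc.IH[OF \<sigma>(1)] by (auto simp: mem_peel_iff)
qed

text \<open>The choice hidden in \<open>collapse\<close> affects only edges, so the triangles lost
  are exactly the free ones. By closure under faces, each two-element subset of a triangle of
  \<open>Y\<close> is an edge of \<open>Y\<close>, as \<open>peel\<close> presupposes.\<close>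

lemma simplexes_2_collapse:
  assumes "finite_2_complex Y"
  shows "simplexes 2 (collapse Y) = peel (simplexes 2 Y)"
proof -
  have edge: "e \<in> simplexes 1 Y \<longleftrightarrow> card e = 2" if "\<sigma> \<in> simplexes 2 Y" "e \<subseteq> \<sigma>" for e \<sigma>
  proof -
    have "e \<in> Y" if "card e = 2"
    proof -
      have "e \<noteq> {}" using that by auto
      then show ?thesis using assms \<open>\<sigma> \<in> simplexes 2 Y\<close> \<open>e \<subseteq> \<sigma>\<close>
        unfolding finite_2_complex_def finite_complex_def simplexes_def by blast
    qed
    then show ?thesis by (auto simp: simplexes_def)
  qed
  have "simplexes 2 (collapse Y) = simplexes 2 Y - free_triangles Y"
    unfolding collapse_def
    by (rule simplexes_2_collapse_along) (rule someI_ex[OF admissible_choice_exists])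
  also have "\<dots> = peel (simplexes 2 Y)"
  proof (rule set_eqI)
    fix \<sigma>
    \<comment> \<open>Once \<open>\<sigma>\<close> is known to contain \<open>e\<close>, uniqueness
      means that no other triangle contains it.\<close>
    have free: "e \<in> free_edges Y \<longleftrightarrow> card e = 2 \<and> \<not> (\<exists>\<tau> \<in> simplexes 2 Y. \<tau> \<noteq> \<sigma> \<and> e \<subseteq> \<tau>)"
      if "\<sigma> \<in> simplexes 2 Y" "e \<subseteq> \<sigma>" for e
    proof -
      have "(\<exists>!\<tau>. \<tau> \<in> simplexes 2 Y \<and> e \<subseteq> \<tau>) \<longleftrightarrow> \<not> (\<exists>\<tau> \<in> simplexes 2 Y. \<tau> \<noteq> \<sigma> \<and> e \<subseteq> \<tau>)"
        using that by (metis (no_types, lifting))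
      then show ?thesis by (simp only: free_edges_def mem_Collect_eq edge[OF that])
    qed
    show "\<sigma> \<in> simplexes 2 Y - free_triangles Y \<longleftrightarrow> \<sigma> \<in> peel (simplexes 2 Y)"
    proof (cases "\<sigma> \<in> simplexes 2 Y")
      case True
      then have "\<sigma> \<in> free_triangles Y \<longleftrightarrow> (\<exists>e. e \<subseteq> \<sigma> \<and> e \<in> free_edges Y)"
        by (auto simp: free_triangles_def)
      also have "\<dots> \<longleftrightarrow> \<sigma> \<notin> peel (simplexes 2 Y)"
        using True by (simp add: mem_peel_iff free[OF True] cong: conj_cong)
      finally show ?thesis using True by simp
    qed (use peel_subset in auto)
  qed
  finally show ?thesis .
qed

lemma finite_2_complex_funpow_collapse:
  "finite_2_complex Y \<Longrightarrow> finite_2_complex ((collapse ^^ i) Y)"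
  by (induction i) (auto intro: finite_2_complex_collapse)

lemma simplexes_2_funpow_collapse:
  assumes "finite_2_complex Y"
  shows "simplexes 2 ((collapse ^^ i) Y) = (peel ^^ i) (simplexes 2 Y)"
  by (induction i)
    (simp_all add: simplexes_2_collapse finite_2_complex_funpow_collapse assms)

text \<open>Serves \<open>collapse_depth\<close>, which refers to membership in the collapsed
  complexes rather than in their sets of triangles.\<close>

lemma mem_funpow_collapse_iff:
  assumes "finite_2_complex Y" "\<sigma> \<in> simplexes 2 Y"
  shows "\<sigma> \<in> (collapse ^^ i) Y \<longleftrightarrow> \<sigma> \<in> (peel ^^ i) (simplexes 2 Y)"
  using assms(2) unfolding simplexes_2_funpow_collapse[OF assms(1), symmetric]
  by (simp add: simplexes_def)

section \<open>Boundary and survival of the center\<close>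

lemma peel_eq_if_boundary_empty:
  assumes "finite_2_complex S" "boundary S = {}"
  shows "peel (simplexes 2 S) = simplexes 2 S"
proof -
  have "e \<notin> free_edges S" for e
  proof
    assume e: "e \<in> free_edges S"
    then have "e \<noteq> {}" by (auto simp: free_edges_def simplexes_def)
    with e have "e \<in> boundary S" by (auto simp: boundary_def)
    then show False using assms(2) by simp
  qed
  then have "free_triangles S = {}" by (auto simp: free_triangles_def)
  then show ?thesis
    using simplexes_2_collapse[OF assms(1)] simplexes_2_collapse_along[of S]
      someI_ex[OF admissible_choice_exists, of S] by (simp add: collapse_def)
qed

lemma peel_neq_if_boundary_nonempty:
  assumes "boundary S \<noteq> {}"
  shows "peel (simplexes 2 S) \<noteq> simplexes 2 S"
proof -
  obtain e where "e \<in> free_edges S" using assms by (auto simp: boundary_def)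
  then obtain \<sigma> where \<sigma>: "\<sigma> \<in> simplexes 2 S" "e \<subseteq> \<sigma>" "card e = 2"
      and unique: "\<And>\<tau>. \<tau> \<in> simplexes 2 S \<Longrightarrow> e \<subseteq> \<tau> \<Longrightarrow> \<tau> = \<sigma>"
    by (auto simp: free_edges_def simplexes_def)
  have "\<sigma> \<notin> peel (simplexes 2 S)"
  proof
    assume "\<sigma> \<in> peel (simplexes 2 S)"
    then have "\<exists>\<tau> \<in> simplexes 2 S. \<tau> \<noteq> \<sigma> \<and> e \<subseteq> \<tau>"
      using \<sigma>(2,3) unfolding mem_peel_iff by simp
    then show False using unique by blast
  qed
  then show ?thesis using \<sigma>(1) by auto
qed

text \<open>Without boundary peeling changes nothing. With boundary, a center lost by stage
  \<open>k\<close> would occur only in earlier stages, which bounds its depth below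
  \<open>k\<close>.\<close>

lemma centered_surface_center_survives:
  assumes "centered_surface k r (S, c)"
  shows "c \<in> (peel ^^ k) (simplexes 2 S)"
proof (cases "boundary S = {}")
  case True
  have "finite_2_complex S" "c \<in> simplexes 2 S"
    using assms by (auto simp: centered_surface_def pseudo_surface_def)
  moreover from peel_eq_if_boundary_empty[OF this(1) True]
  have "(peel ^^ k) (simplexes 2 S) = simplexes 2 S" by (induction k) simp_all
  ultimately show ?thesis by simp
next
  case False
  have S: "finite_2_complex S" and c: "c \<in> simplexes 2 S" and d: "collapse_depth S c = enat k"
    using assms False by (auto simp: centered_surface_def pseudo_surface_def)
  show ?thesis
  proof (rule ccontr)
    assume nc: "c \<notin> (peel ^^ k) (simplexes 2 S)"
    \<comment> \<open>Stage 0 contains \<open>c\<close>, so \<open>k - 1\<close> is a true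
      predecessor and not a truncated one.\<close>
    then have "k \<noteq> 0" using c by (cases k) auto
    have "i \<le> k - 1" if "c \<in> (collapse ^^ i) S" for i
    proof (rule ccontr)
      assume "\<not> i \<le> k - 1"
      then have "k \<le> i" by simp
      then show False
        using nc that funpow_peel_antimono mem_funpow_collapse_iff[OF S c] by blast
    qed
    then have "collapse_depth S c \<le> enat (k - 1)"
      unfolding collapse_depth_def by (intro Sup_least) auto
    then show False using d \<open>k \<noteq> 0\<close> by simp
  qed
qed

section \<open>Distance between triangles\<close>

text \<open>As powers of a relation, paths are concatenated and reversed by relation algebra. Both
  ends are restricted to \<open>T\<close> so that paths stay inside \<open>T\<close>.\<close>

definition adj_rel :: "'a set set \<Rightarrow> ('a set \<times> 'a set) set" where
  "adj_rel T = {(\<sigma>, \<tau>). \<sigma> \<in> T \<and> \<tau> \<in> T \<and> adjacent \<sigma> \<tau>}"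

lemma sym_adj_rel: "sym (adj_rel T)"
  by (auto simp: sym_def adj_rel_def adjacent_def Int_commute)

lemma sym_relpow: "sym R \<Longrightarrow> sym (R ^^ n)"
proof (induction n)
  case 0
  then show ?case by (simp add: sym_Id)
next
  case (Suc n)
  then have "(R ^^ Suc n)\<inverse> = R ^^ Suc n"
    by (simp add: sym_conv_converse_eq converse_relcomp relpow_commute)
  then show ?case by (simp add: sym_conv_converse_eq)
qed

text \<open>The zeroth power of \<open>adj_rel\<close> is the identity on all sets, so membership of
  the starting triangle is a separate condition; later triangles get theirs from the
  relation.\<close>

lemma triangle_path_iff:
  "triangle_path S \<sigma> \<tau> m \<longleftrightarrow>
     \<sigma> \<in> simplexes 2 S \<and> (\<sigma>, \<tau>) \<in> adj_rel (simplexes 2 S) ^^ m"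
proof -
  have "(\<forall>i\<le>m. s i \<in> simplexes 2 S) \<and> (\<forall>i<m. adjacent (s i) (s (Suc i))) \<longleftrightarrow>
      s 0 \<in> simplexes 2 S \<and> (\<forall>i<m. (s i, s (Suc i)) \<in> adj_rel (simplexes 2 S))" for s
  proof -
    have "s i \<in> simplexes 2 S" if "s 0 \<in> simplexes 2 S" "i \<le> m"
      "\<forall>i<m. (s i, s (Suc i)) \<in> adj_rel (simplexes 2 S)" for i
      using that by (cases i) (auto simp: adj_rel_def)
    then show ?thesis by (auto simp: adj_rel_def)
  qed
  then show ?thesis
    unfolding triangle_path_def relpow_fun_conv by (simp only:) blast
qed

lemma triangle_dist_le:
  assumes "\<sigma> \<in> simplexes 2 S" "(\<sigma>, \<tau>) \<in> adj_rel (simplexes 2 S) ^^ m" "m \<le> n"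
  shows "triangle_dist S \<sigma> \<tau> \<le> enat n"
proof -
  have "triangle_dist S \<sigma> \<tau> \<le> enat m"
    unfolding triangle_dist_def using assms by (intro Inf_lower) (auto simp: triangle_path_iff)
  then show ?thesis using assms(3) by (meson enat_ord_simps(1) order_trans)
qed

text \<open>Bounding the path length avoids the infimum in \<open>triangle_dist\<close>. For
  \<open>c\<close> outside \<open>T\<close> the path of length 0 still puts \<open>c\<close> into
  the ball.\<close>

definition tri_ball :: "'a set set \<Rightarrow> 'a set \<Rightarrow> nat \<Rightarrow> 'a set set" where
  "tri_ball T c k = {\<tau>. \<exists>m\<le>k. (c, \<tau>) \<in> adj_rel T ^^ m}"

lemma tri_ball_subset: "c \<in> T \<Longrightarrow> tri_ball T c k \<subseteq> T"
proof
  fix \<tau> assume "c \<in> T" "\<tau> \<in> tri_ball T c k"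
  then obtain m where "(c, \<tau>) \<in> adj_rel T ^^ m" by (auto simp: tri_ball_def)
  then show "\<tau> \<in> T" using \<open>c \<in> T\<close> by (cases m) (auto simp: adj_rel_def)
qed

text \<open>Distinct three-element sets share at most two vertices, and the common edge supplies
  two.\<close>

lemma adjacent_if_common_edge:
  assumes "card \<sigma> = 3" "card \<tau> = 3" "\<sigma> \<noteq> \<tau>" "e \<subseteq> \<sigma>" "e \<subseteq> \<tau>" "card e = 2"
  shows "adjacent \<sigma> \<tau>"
proof -
  have fin: "finite \<sigma>" "finite \<tau>" using assms(1,2) card.infinite by fastforce+
  have "\<sigma> \<inter> \<tau> \<noteq> \<sigma>"
    using assms(1-3) card_subset_eq[OF fin(2), of \<sigma>] by auto
  then have "card (\<sigma> \<inter> \<tau>) < 3" using psubset_card_mono[OF fin(1), of "\<sigma> \<inter> \<tau>"] assms(1) by auto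
  moreover have "2 \<le> card (\<sigma> \<inter> \<tau>)"
    using card_mono[of "\<sigma> \<inter> \<tau>" e] fin assms by auto
  ultimately show ?thesis unfolding adjacent_def by simp
qed

text \<open>Locality of peeling. The triangles that protect \<open>\<tau>\<close> are one step
  further from \<open>c\<close> but must survive one peeling fewer, so the budget
  \<open>m + i \<le> k\<close> is preserved by the induction and every triangle consulted lies in
  the ball.\<close>

lemma funpow_peel_tri_ball:
  assumes card3: "\<And>\<sigma>. \<sigma> \<in> T \<Longrightarrow> card \<sigma> = 3"
  shows "m + i \<le> k \<Longrightarrow> (c, \<tau>) \<in> adj_rel T ^^ m \<Longrightarrow> \<tau> \<in> (peel ^^ i) T
    \<Longrightarrow> \<tau> \<in> (peel ^^ i) (tri_ball T c k)"
proof (induction i arbitrary: m \<tau>)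
  case 0
  then show ?case by (auto simp: tri_ball_def)
next
  case (Suc i)
  have \<tau>: "\<tau> \<in> (peel ^^ i) T" using Suc.prems(3) peel_subset by auto
  have "\<exists>\<rho> \<in> (peel ^^ i) (tri_ball T c k). \<rho> \<noteq> \<tau> \<and> e \<subseteq> \<rho>" if e: "e \<subseteq> \<tau>" "card e = 2" for e
  proof -
    obtain \<rho> where \<rho>: "\<rho> \<in> (peel ^^ i) T" "\<rho> \<noteq> \<tau>" "e \<subseteq> \<rho>"
      using Suc.prems(3) e unfolding funpow.simps o_apply mem_peel_iff by blast
    have "\<tau> \<in> T" "\<rho> \<in> T" using \<tau> \<rho>(1) funpow_peel_subset by blast+
    then have "(\<tau>, \<rho>) \<in> adj_rel T"
      using adjacent_if_common_edge[of \<tau> \<rho> e] card3 \<rho> e by (auto simp: adj_rel_def)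
    then have "(c, \<rho>) \<in> adj_rel T ^^ Suc m" using Suc.prems(2) by auto
    then show ?thesis using Suc.IH[of "Suc m" \<rho>] Suc.prems(1) \<rho> by auto
  qed
  moreover have "\<tau> \<in> (peel ^^ i) (tri_ball T c k)"
    using Suc.IH[of m \<tau>] Suc.prems \<tau> by simp
  ultimately show ?case by (auto simp: mem_peel_iff)
qed

text \<open>Any two triangles are joined through \<open>c\<close>, reversing one of the paths, which
  bounds all distances by \<open>k + k\<close>.\<close>

lemma strongly_connected_if_ball:
  assumes "c \<in> simplexes 2 S" "simplexes 2 S \<subseteq> tri_ball (simplexes 2 S) c k"
  shows "strongly_connected S"
proof -
  have "triangle_dist S \<sigma> \<tau> \<le> enat (k + k)"
    if \<sigma>: "\<sigma> \<in> simplexes 2 S" and \<tau>: "\<tau> \<in> simplexes 2 S" for \<sigma> \<tau>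
  proof -
    let ?R = "adj_rel (simplexes 2 S)"
    obtain m n where mn: "m \<le> k" "n \<le> k" "(c, \<sigma>) \<in> ?R ^^ m" "(c, \<tau>) \<in> ?R ^^ n"
      using \<sigma> \<tau> assms(2) unfolding tri_ball_def by blast
    then have "(\<sigma>, \<tau>) \<in> ?R ^^ (m + n)"
      using sym_relpow[OF sym_adj_rel] unfolding relpow_add by (meson relcompI symD)
    then show ?thesis using triangle_dist_le[OF \<sigma>] mn by simp
  qed
  then have "(SUP \<sigma> \<in> simplexes 2 S. SUP \<tau> \<in> simplexes 2 S. triangle_dist S \<sigma> \<tau>) \<le> enat (k + k)"
    by (intro SUP_least)
  then show ?thesis unfolding strongly_connected_def by (rule le_less_trans) simp
qed

section \<open>Subcomplexes spanned by triangles\<close>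

text \<open>The subcomplex generated by \<open>T\<close>.\<close>

definition span_complex :: "'a set set \<Rightarrow> 'a set set" where
  "span_complex T = {\<rho>. \<rho> \<noteq> {} \<and> (\<exists>\<sigma>\<in>T. \<rho> \<subseteq> \<sigma>)}"

lemma degree_le_subset:
  assumes "degree_le r Y" "S \<subseteq> Y" "finite Y"
  shows "degree_le r S"
  unfolding degree_le_def
proof
  fix e assume "e \<in> simplexes 1 S"
  then have "card {\<sigma> \<in> simplexes 2 Y. e \<subseteq> \<sigma>} \<le> r"
    using assms by (auto simp: degree_le_def simplexes_def)
  moreover have "card {\<sigma> \<in> simplexes 2 S. e \<subseteq> \<sigma>} \<le> card {\<sigma> \<in> simplexes 2 Y. e \<subseteq> \<sigma>}"
    using assms by (intro card_mono) (auto simp: simplexes_def)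
  ultimately show "card {\<sigma> \<in> simplexes 2 S. e \<subseteq> \<sigma>} \<le> r" by simp
qed

text \<open>A face with three vertices is the whole triangle, so no triangles are added; purity
  holds because every face lies in some member of \<open>T\<close>.\<close>

lemma span_complex_simps:
  assumes Y: "finite_2_complex Y" and T: "T \<subseteq> simplexes 2 Y"
  shows "span_complex T \<subseteq> Y" "finite_2_complex (span_complex T)"
    "simplexes 2 (span_complex T) = T" "pure (span_complex T)"
proof -
  have card3: "card \<sigma> = 3" "finite \<sigma>" "\<sigma> \<noteq> {}" "\<sigma> \<in> Y" if "\<sigma> \<in> T" for \<sigma>
    using that T card.infinite by (fastforce simp: simplexes_def)+
  show sub: "span_complex T \<subseteq> Y"
    using Y card3(4) unfolding span_complex_def finite_2_complex_def finite_complex_def by blast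
  show "finite_2_complex (span_complex T)"
    unfolding finite_2_complex_def finite_complex_def
  proof (intro conjI ballI allI impI)
    show "finite (span_complex T)"
      using Y sub finite_subset unfolding finite_2_complex_def finite_complex_def by blast
    show "\<tau> \<in> span_complex T" if "\<sigma> \<in> span_complex T" "\<tau> \<noteq> {} \<and> \<tau> \<subseteq> \<sigma>" for \<sigma> \<tau>
      using that unfolding span_complex_def by blast
    show "finite \<sigma>" "\<sigma> \<noteq> {}" "card \<sigma> \<le> 3" if "\<sigma> \<in> span_complex T" for \<sigma>
      using subsetD[OF sub that] Y unfolding finite_2_complex_def finite_complex_def by auto
  qed
  have eq: "\<rho> = \<sigma>" if "\<sigma> \<in> T" "\<rho> \<subseteq> \<sigma>" "card \<rho> = 3" for \<rho> \<sigma>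
    using that card3[of \<sigma>] card_subset_eq by metis
  have "T \<subseteq> span_complex T" using card3(3) unfolding span_complex_def by blast
  have simp2: "simplexes 2 (span_complex T) = T"
  proof
    show "T \<subseteq> simplexes 2 (span_complex T)"
      using \<open>T \<subseteq> span_complex T\<close> card3(1) by (auto simp: simplexes_def)
    show "simplexes 2 (span_complex T) \<subseteq> T"
    proof
      fix \<rho> assume "\<rho> \<in> simplexes 2 (span_complex T)"
      then obtain \<sigma> where "\<sigma> \<in> T" "\<rho> \<subseteq> \<sigma>" "card \<rho> = 3"
        by (auto simp: simplexes_def span_complex_def)
      then show "\<rho> \<in> T" using eq by blast
    qed
  qed
  show "simplexes 2 (span_complex T) = T" by (fact simp2)
  show "pure (span_complex T)"
    unfolding pure_def simp2 using \<open>T \<subseteq> span_complex T\<close> unfolding span_complex_def by blast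
qed

section \<open>A minimal surviving set of triangles\<close>

lemma ex_centered_subsurface:
  assumes Y: "finite_2_complex Y" and deg: "degree_le r Y"
    and nc: "\<not> collapsible_to_graph_in k Y"
  obtains S c where "S \<subseteq> Y" "centered_surface k r (S, c)"
proof -
  define P where "P T \<longleftrightarrow> T \<subseteq> simplexes 2 Y \<and> (peel ^^ k) T \<noteq> {}" for T
  have finY: "finite Y" using Y by (simp add: finite_2_complex_def finite_complex_def)
  then have fin2: "finite (simplexes 2 Y)" by (simp add: simplexes_def)
  have "P (simplexes 2 Y)"
    using nc simplexes_2_funpow_collapse[OF Y]
    by (simp add: P_def collapsible_to_graph_in_def)
  from ex_has_least_nat[where P = P and m = card, OF this] obtain T
    where T: "P T" and min: "\<And>U. P U \<Longrightarrow> card T \<le> card U" by blast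
  have TY: "T \<subseteq> simplexes 2 Y" and "finite T"
    using T fin2 finite_subset by (auto simp: P_def)
  \<comment> \<open>The form in which minimality is used, once for the ball around \<open>c\<close>
    and once for \<open>peel T\<close>.\<close>
  have subset_eq: "U = T" if "U \<subseteq> T" "(peel ^^ k) U \<noteq> {}" for U
  proof -
    have "P U" using that TY by (auto simp: P_def)
    then show ?thesis using card_seteq[OF \<open>finite T\<close> that(1)] min by blast
  qed
  obtain c where c: "c \<in> (peel ^^ k) T" using T by (auto simp: P_def)
  then have cT: "c \<in> T" using funpow_peel_subset by blast
  \<comment> \<open>Starting at \<open>m = 0\<close> with \<open>i = k\<close> uses up the whole
    budget, so radius \<open>k\<close> suffices.\<close>
  have "c \<in> (peel ^^ k) (tri_ball T c k)"
    by (rule funpow_peel_tri_ball[of _ 0]) (use TY c in \<open>auto simp: simplexes_def\<close>)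
  then have ball: "tri_ball T c k = T"
    using tri_ball_subset[OF cT] by (intro subset_eq) auto
  define S where "S = span_complex T"
  note S = span_complex_simps[OF Y TY, folded S_def]
  have depth: "collapse_depth S c = enat k" if "boundary S \<noteq> {}"
  proof (rule antisym)
    have "peel T \<noteq> T" using peel_neq_if_boundary_nonempty[OF that] S(3) by simp
    \<comment> \<open>Otherwise \<open>peel T\<close>, a proper subset, would contradict minimality.
      Counting this first peeling, \<open>T\<close> is exhausted after \<open>Suc k\<close>.\<close>
    then have "(peel ^^ k) (peel T) = {}" using subset_eq[OF peel_subset] by blast
    then have empty: "(peel ^^ Suc k) T = {}" by (simp only: funpow_Suc_right o_apply)
    have "i \<le> k" if "c \<in> (collapse ^^ i) S" for i
    proof (rule ccontr)
      assume "\<not> i \<le> k"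
      then have "(peel ^^ i) T \<subseteq> (peel ^^ Suc k) T" by (intro funpow_peel_antimono) simp
      moreover have "c \<in> (peel ^^ i) T"
        using that mem_funpow_collapse_iff[OF S(2)] cT unfolding S(3) by blast
      ultimately show False using empty by blast
    qed
    then show "collapse_depth S c \<le> enat k"
      unfolding collapse_depth_def by (intro Sup_least) auto
    have "c \<in> (collapse ^^ k) S"
      using c mem_funpow_collapse_iff[OF S(2)] cT unfolding S(3) by blast
    then show "enat k \<le> collapse_depth S c"
      unfolding collapse_depth_def by (intro Sup_upper) auto
  qed
  have dist: "triangle_dist S c \<sigma> \<le> enat k" if "\<sigma> \<in> T" for \<sigma>
  proof -
    have "\<sigma> \<in> tri_ball T c k" using that ball by simp
    then obtain m where "m \<le> k" "(c, \<sigma>) \<in> adj_rel T ^^ m" by (auto simp: tri_ball_def)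
    then show ?thesis using triangle_dist_le[of c S] cT S(3) by simp
  qed
  have "strongly_connected S"
    by (rule strongly_connected_if_ball[of c _ k]) (simp_all add: S(3) ball cT)
  then have "centered_surface k r (S, c)"
    using S cT depth dist degree_le_subset[OF deg S(1) finY]
    by (auto simp: centered_surface_def pseudo_surface_def)
  then show ?thesis using that S(1) by blast
qed

section \<open>Embeddings\<close>

text \<open>Serves both directions of the theorem: for a surface embedded in \<open>Y\<close>, and
  for carrying \<open>Y\<close> over to a copy with other vertices.\<close>

lemma not_collapsible_embedding:
  assumes "finite_2_complex S" "finite_2_complex Y" "simplicial_embedding f S Y"
    and "\<sigma> \<in> (peel ^^ k) (simplexes 2 S)"
  shows "\<not> collapsible_to_graph_in k Y"
proof -
  have inj: "inj_on f (\<Union>S)" and Y: "\<And>\<sigma>. \<sigma> \<in> S \<Longrightarrow> f ` \<sigma> \<in> Y"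
    using assms(3) by (auto simp: simplicial_embedding_def)
  have "f ` \<sigma> \<in> (peel ^^ k) (simplexes 2 Y)"
  proof (rule funpow_peel_image[OF _ _ assms(4)])
    show "inj_on f (\<Union> (simplexes 2 S))"
      using inj by (rule inj_on_subset) (auto simp: simplexes_def)
    show "f ` \<tau> \<in> simplexes 2 Y" if "\<tau> \<in> simplexes 2 S" for \<tau>
      using that Y card_image[OF inj_on_subset[OF inj, of \<tau>]] by (auto simp: simplexes_def)
  qed
  then show ?thesis
    unfolding collapsible_to_graph_in_def simplexes_2_funpow_collapse[OF assms(2)] by blast
qed

lemma
  fixes f :: "'a \<Rightarrow> 'b"
  assumes Y: "finite_2_complex Y" and inj: "inj_on f (\<Union>Y)"
  shows finite_2_complex_image: "finite_2_complex ((`) f ` Y)"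
    and degree_le_image: "degree_le r Y \<Longrightarrow> degree_le r ((`) f ` Y)"
proof -
  have card: "card (f ` \<sigma>) = card \<sigma>" if "\<sigma> \<in> Y" for \<sigma>
    using card_image[OF inj_on_subset[OF inj Union_upper[OF that]]] .
  have face: "\<tau> \<in> (`) f ` Y" if \<sigma>: "\<sigma> \<in> Y" and \<tau>: "\<tau> \<noteq> {}" "\<tau> \<subseteq> f ` \<sigma>" for \<sigma> \<tau>
  proof -
    obtain \<rho> where \<rho>: "\<rho> \<subseteq> \<sigma>" "\<tau> = f ` \<rho>" using \<tau>(2) by (auto simp: subset_image_iff)
    then have "\<rho> \<noteq> {}" using \<tau>(1) by auto
    then have "\<rho> \<in> Y"
      using Y \<sigma> \<rho>(1) unfolding finite_2_complex_def finite_complex_def by blast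
    then show ?thesis using \<rho>(2) by blast
  qed
  have finY: "finite Y" using Y by (simp add: finite_2_complex_def finite_complex_def)
  show "finite_2_complex ((`) f ` Y)"
    unfolding finite_2_complex_def finite_complex_def
  proof (intro conjI ballI allI impI)
    show "finite ((`) f ` Y)" using finY by simp
    show "\<tau> \<in> (`) f ` Y" if "\<sigma> \<in> (`) f ` Y" "\<tau> \<noteq> {} \<and> \<tau> \<subseteq> \<sigma>" for \<sigma> \<tau>
      using that face by blast
    show "finite \<sigma>" "\<sigma> \<noteq> {}" "card \<sigma> \<le> 3" if "\<sigma> \<in> (`) f ` Y" for \<sigma>
      using that Y card unfolding finite_2_complex_def finite_complex_def by auto
  qed
  show "degree_le r ((`) f ` Y)" if deg: "degree_le r Y"
    unfolding degree_le_def
  proof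
    fix e' assume "e' \<in> simplexes 1 ((`) f ` Y)"
    then obtain e where e: "e \<in> simplexes 1 Y" "e' = f ` e"
      using card by (auto simp: simplexes_def)
    have "{\<sigma> \<in> simplexes 2 ((`) f ` Y). e' \<subseteq> \<sigma>} \<subseteq> (`) f ` {\<sigma> \<in> simplexes 2 Y. e \<subseteq> \<sigma>}"
    proof
      fix \<sigma>' assume "\<sigma>' \<in> {\<sigma> \<in> simplexes 2 ((`) f ` Y). e' \<subseteq> \<sigma>}"
      then obtain \<sigma> where \<sigma>: "\<sigma> \<in> simplexes 2 Y" "\<sigma>' = f ` \<sigma>" "f ` e \<subseteq> f ` \<sigma>"
        using card e(2) by (auto simp: simplexes_def)
      then have "e \<subseteq> \<sigma>"
        using inj_on_image_mem_iff[OF inj, of _ \<sigma>] e(1)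
        by (metis (no_types, lifting) Union_upper image_eqI mem_Collect_eq simplexes_def subset_iff)
      then show "\<sigma>' \<in> (`) f ` {\<sigma> \<in> simplexes 2 Y. e \<subseteq> \<sigma>}" using \<sigma> by blast
    qed
    moreover have "finite {\<sigma> \<in> simplexes 2 Y. e \<subseteq> \<sigma>}" using finY by (simp add: simplexes_def)
    ultimately have "card {\<sigma> \<in> simplexes 2 ((`) f ` Y). e' \<subseteq> \<sigma>} \<le> card {\<sigma> \<in> simplexes 2 Y. e \<subseteq> \<sigma>}"
      by (meson card_image_le card_mono finite_imageI order_trans)
    also have "\<dots> \<le> r" using deg e(1) by (simp add: degree_le_def)
    finally show "card {\<sigma> \<in> simplexes 2 ((`) f ` Y). e' \<subseteq> \<sigma>} \<le> r" .
  qed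
qed

section \<open>Isomorphism types and the two directions\<close>

lemma ex_embeds_iff:
  "(\<exists>\<S> \<in> \<L> k r. embeds \<S> Y) \<longleftrightarrow>
     (\<exists>(S :: nat set set) c f. centered_surface k r (S, c) \<and> simplicial_embedding f S Y)"
proof
  assume "\<exists>\<S> \<in> \<L> k r. embeds \<S> Y"
  then obtain \<S> S c f where "\<S> \<in> \<L> k r" "(S, c) \<in> \<S>" "simplicial_embedding f S Y"
    unfolding embeds_def by blast
  moreover from this(1,2) have "centered_surface k r (S, c)"
    unfolding \<L>_def by (elim quotientE) simp
  ultimately show "\<exists>(S :: nat set set) c f. centered_surface k r (S, c) \<and> simplicial_embedding f S Y" by blast
next
  let ?R = "{(x :: nat set set \<times> nat set, y :: nat set set \<times> nat set).
    centered_surface k r x \<and> centered_surface k r y \<and> centered_iso x y}"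
  assume "\<exists>(S :: nat set set) c f. centered_surface k r (S, c) \<and> simplicial_embedding f S Y"
  then obtain S :: "nat set set" and c f
    where S: "centered_surface k r (S, c)" "simplicial_embedding f S Y" by blast
  \<comment> \<open>Reflexivity puts \<open>(S, c)\<close> into its own class, which is then the
    required isomorphism type.\<close>
  have "equiv (Collect (centered_surface k r)) ?R"
    by (rule equiv_centered_iso) (auto simp: centered_surface_def simplexes_def)
  then have "(S, c) \<in> ?R `` {(S, c)}" using S(1) by (intro equiv_class_self) auto
  then have "embeds (?R `` {(S, c)}) Y"
    unfolding embeds_def by (rule bexI[rotated]) (use S(2) in auto)
  moreover have "?R `` {(S, c)} \<in> \<L> k r" unfolding \<L>_def using S(1) by (intro quotientI) simp
  ultimately show "\<exists>\<S> \<in> \<L> k r. embeds \<S> Y" by (rule bexI)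
qed

theorem theorem13:
  fixes Y :: "'a set set" and k r :: nat
  assumes "r \<ge> 2"
    and "finite_2_complex Y"
    and "degree_le r Y"
  shows "\<not> collapsible_to_graph_in k Y \<longleftrightarrow> (\<exists>S \<in> \<L> k r. embeds S Y)"
  unfolding ex_embeds_iff
proof
  assume nc: "\<not> collapsible_to_graph_in k Y"
  have "finite (\<Union>Y)" using assms(2) by (auto simp: finite_2_complex_def finite_complex_def)
  \<comment> \<open>Representatives in \<open>\<L> k r\<close> have natural numbers as vertices, so
    the surface is sought in a copy \<open>Z\<close> of \<open>Y\<close> on such vertices.\<close>
  then obtain f :: "'a \<Rightarrow> nat" where inj: "inj_on f (\<Union>Y)"
    by (metis finite_imp_inj_to_nat_seg)
  define Z where "Z = (`) f ` Y"
  have Z: "finite_2_complex Z" "degree_le r Z"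
    unfolding Z_def
    by (rule finite_2_complex_image[OF assms(2) inj], rule degree_le_image[OF assms(2) inj assms(3)])
  have "simplicial_embedding f Y Z" using inj by (auto simp: simplicial_embedding_def Z_def)
  moreover obtain \<sigma> where "\<sigma> \<in> (peel ^^ k) (simplexes 2 Y)"
    using nc simplexes_2_funpow_collapse[OF assms(2)]
    by (auto simp: collapsible_to_graph_in_def)
  ultimately have "\<not> collapsible_to_graph_in k Z"
    by (rule not_collapsible_embedding[OF assms(2) Z(1)])
  then obtain S c where S: "S \<subseteq> Z" "centered_surface k r (S, c)"
    using ex_centered_subsurface[OF Z] by blast
  \<comment> \<open>Since \<open>S\<close> lies in \<open>Z\<close>, all its vertices are values of
    \<open>f\<close>, and the inverse of \<open>f\<close> carries \<open>S\<close> back into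
    \<open>Y\<close>.\<close>
  define g where "g = inv_into (\<Union>Y) f"
  have "g ` f ` \<sigma> = \<sigma>" if "\<sigma> \<in> Y" for \<sigma>
    unfolding g_def using that inj by (intro inv_into_image_cancel) auto
  moreover have "\<Union>S \<subseteq> f ` \<Union>Y" using Union_mono[OF S(1)] by (simp add: Z_def image_Union)
  then have "inj_on g (\<Union>S)" unfolding g_def by (rule inj_on_inv_into)
  ultimately have "simplicial_embedding g S Y"
    using S(1) by (auto simp: simplicial_embedding_def Z_def)
  then show "\<exists>(S :: nat set set) c f. centered_surface k r (S, c) \<and> simplicial_embedding f S Y"
    using S(2) by blast
next
  assume "\<exists>(S :: nat set set) c f. centered_surface k r (S, c) \<and> simplicial_embedding f S Y"
  then obtain S :: "nat set set" and c f
    where S: "centered_surface k r (S, c)" "simplicial_embedding f S Y" by blast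
  have "finite_2_complex S" using S(1) by (simp add: centered_surface_def pseudo_surface_def)
  from this assms(2) S(2) centered_surface_center_survives[OF S(1)]
  show "\<not> collapsible_to_graph_in k Y" by (rule not_collapsible_embedding)
qed

end
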